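(* Let $G$ be a connected bipartite even plane multigraph. Then all cycle decompositions $\mathcal{D}$ of $G$ have the same sign.
   Context: A multigraph may have parallel edges but no self-loops; it is plane if embedded in the plane without crossings, parallel edges being drawn so as not to enclose any vertex. It is even if every vertex has even degree. A cycle decomposition of $G$ is a multiset of edge-disjoint cycles whose edge sets together cover $E(G)$. For a cycle $c$, $\chi(c)$ is the number of vertices of $G$ enclosed by $c$. For a bipartite plane multigraph, the sign of a cycle decomposition $\mathcal{D}=\{d_1,\dots,d_k\}$ is $\operatorname{sgn}(\mathcal{D})=\prod_{i=1}^k(-1)^{\chi(d_i)+1}$. *)

theory Defs
  imports "HOL-Analysis.Analysis"
begin

text \<open>A plane multigraph is given concretely by its drawing in the plane (identified with
the complex numbers): a finite set V of points (the vertices), a finite set E of edge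
labels, and for each edge e an arc g e from one vertex to a different vertex (no self-loops);
parallel edges are simply distinct labels whose arcs have the same endpoints.\<close>

definition ends :: "('e \<Rightarrow> real \<Rightarrow> complex) \<Rightarrow> 'e \<Rightarrow> complex set" where
  "ends g e = {pathstart (g e), pathfinish (g e)}"

definition plane_multigraph ::
  "complex set \<Rightarrow> 'e set \<Rightarrow> ('e \<Rightarrow> real \<Rightarrow> complex) \<Rightarrow> bool" where
  "plane_multigraph V E g \<longleftrightarrow>
     finite V \<and> finite E \<and>
     (\<forall>e\<in>E. arc (g e) \<and> pathstart (g e) \<in> V \<and> pathfinish (g e) \<in> V
             \<and> pathstart (g e) \<noteq> pathfinish (g e)
             \<and> path_image (g e) \<inter> V = ends g e) \<and>
     (\<forall>e\<in>E. \<forall>f\<in>E. e \<noteq> f \<longrightarrow> path_image (g e) \<inter> path_image (g f) \<subseteq> ends g e \<inter> ends g f) \<and>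
     (\<comment> \<open>parallel edges are drawn so as not to enclose any vertex\<close>
      \<forall>e\<in>E. \<forall>f\<in>E. e \<noteq> f \<longrightarrow> ends g e = ends g f \<longrightarrow>
        V \<inter> inside (path_image (g e) \<union> path_image (g f)) = {})"

definition adjacent ::
  "'e set \<Rightarrow> ('e \<Rightarrow> real \<Rightarrow> complex) \<Rightarrow> complex \<Rightarrow> complex \<Rightarrow> bool" where
  "adjacent E g u v \<longleftrightarrow> (\<exists>e\<in>E. ends g e = {u, v} \<and> u \<noteq> v)"

definition connected_graph ::
  "complex set \<Rightarrow> 'e set \<Rightarrow> ('e \<Rightarrow> real \<Rightarrow> complex) \<Rightarrow> bool" where
  "connected_graph V E g \<longleftrightarrow> (\<forall>u\<in>V. \<forall>v\<in>V. (adjacent E g)\<^sup>*\<^sup>* u v)"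

definition bipartite_graph ::
  "complex set \<Rightarrow> 'e set \<Rightarrow> ('e \<Rightarrow> real \<Rightarrow> complex) \<Rightarrow> bool" where
  "bipartite_graph V E g \<longleftrightarrow>
     (\<exists>A B. A \<union> B = V \<and> A \<inter> B = {} \<and>
        (\<forall>e\<in>E. (pathstart (g e) \<in> A \<and> pathfinish (g e) \<in> B) \<or>
                (pathstart (g e) \<in> B \<and> pathfinish (g e) \<in> A)))"

definition degree :: "'e set \<Rightarrow> ('e \<Rightarrow> real \<Rightarrow> complex) \<Rightarrow> complex \<Rightarrow> nat" where
  "degree E g v = card {e\<in>E. v \<in> ends g e}"

definition even_graph ::
  "complex set \<Rightarrow> 'e set \<Rightarrow> ('e \<Rightarrow> real \<Rightarrow> complex) \<Rightarrow> bool" where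
  "even_graph V E g \<longleftrightarrow> (\<forall>v\<in>V. even (degree E g v))"

text \<open>A cycle, represented by its (nonempty) edge set: edges e_0..e_{k-1} (k \<ge> 2, distinct)
through distinct vertices v_0..v_{k-1}, edge e_i joining v_i and v_{i+1 mod k}.
For k = 2 this is a pair of parallel edges.\<close>

definition is_cycle :: "'e set \<Rightarrow> ('e \<Rightarrow> real \<Rightarrow> complex) \<Rightarrow> 'e set \<Rightarrow> bool" where
  "is_cycle E g C \<longleftrightarrow>
     (\<exists>vs es. length es = length vs \<and> length es \<ge> 2 \<and> distinct es \<and> distinct vs \<and>
        set es = C \<and> C \<subseteq> E \<and>
        (\<forall>i<length es. ends g (es ! i) = {vs ! i, vs ! ((i + 1) mod length es)}))"

text \<open>Cycle decomposition: edge-disjoint cycles covering all edges (since the cycles are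
edge-disjoint and nonempty, the multiset is a set of edge sets).\<close>

definition cycle_decomposition ::
  "'e set \<Rightarrow> ('e \<Rightarrow> real \<Rightarrow> complex) \<Rightarrow> 'e set set \<Rightarrow> bool" where
  "cycle_decomposition E g D \<longleftrightarrow>
     (\<forall>C\<in>D. is_cycle E g C) \<and>
     (\<forall>C\<in>D. \<forall>C'\<in>D. C \<noteq> C' \<longrightarrow> C \<inter> C' = {}) \<and>
     \<Union>D = E"

definition chi :: "complex set \<Rightarrow> ('e \<Rightarrow> real \<Rightarrow> complex) \<Rightarrow> 'e set \<Rightarrow> nat" where
  "chi V g C = card {v\<in>V. v \<in> inside (\<Union>e\<in>C. path_image (g e))}"

definition sgn_decomp ::
  "complex set \<Rightarrow> ('e \<Rightarrow> real \<Rightarrow> complex) \<Rightarrow> 'e set set \<Rightarrow> int" where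
  "sgn_decomp V g D = (\<Prod>C\<in>D. (-1) ^ (chi V g C + 1))"

end

theory Submission
  imports Defs "HOL-Complex_Analysis.Winding_Numbers"
begin

text \<open>A Kasteleyn signing shows that the sign does not depend on the decomposition. For a cycle \<open>C\<close>
put \<open>F(C) = |C|/2 + \<chi>(C) + 1\<close>. If three internally disjoint paths join \<open>a\<close> to \<open>b\<close>, one of them
lies inside the cycle formed by the other two, so the Jordan curve theorem together with the equal
parities of the path lengths gives that the \<open>F\<close>-values of the three cycles have even sum.
As in Zaslavsky's characterization of signed graphs, such an \<open>F\<close> is induced by an edge labelling \<open>s\<close>:
\<open>F(C) = \<Sum>e\<in>C. s e\<close> modulo 2 for every cycle. Summing over a decomposition, the exponent
of the sign is \<open>|E|/2 + \<Sum>e\<in>E. s e\<close> modulo 2.\<close>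

section \<open>Theta curves in the plane\<close>

definition theta_arcs :: "complex \<Rightarrow> complex \<Rightarrow> (real \<Rightarrow> complex) \<Rightarrow> (real \<Rightarrow> complex) \<Rightarrow> (real \<Rightarrow> complex) \<Rightarrow> bool" where
  "theta_arcs a b p q r \<longleftrightarrow> a \<noteq> b \<and> arc p \<and> arc q \<and> arc r \<and>
     pathstart p = a \<and> pathfinish p = b \<and> pathstart q = a \<and> pathfinish q = b \<and>
     pathstart r = a \<and> pathfinish r = b \<and>
     path_image p \<inter> path_image q = {a, b} \<and> path_image p \<inter> path_image r = {a, b} \<and>
     path_image q \<inter> path_image r = {a, b}"

lemma theta_arcs_swap: "theta_arcs a b p q r \<Longrightarrow> theta_arcs a b q p r"
  and theta_arcs_rotate: "theta_arcs a b p q r \<Longrightarrow> theta_arcs a b q r p"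
  unfolding theta_arcs_def by auto

section \<open>Winding numbers of the cycles of a theta curve\<close>

lemma simple_path_join_reversepath:
  assumes "arc p" "arc q" "pathstart p = a" "pathfinish p = b" "pathstart q = a" "pathfinish q = b"
    and "path_image p \<inter> path_image q = {a, b}"
  shows "simple_path (p +++ reversepath q)"
  using assms by (intro simple_path_join_loop) (auto simp: arc_reversepath)

text \<open>The winding number vanishes outside a simple loop and has norm 1 inside it.\<close>

lemma winding_number_eq_0_iff_not_inside:
  assumes "simple_path \<gamma>" "pathfinish \<gamma> = pathstart \<gamma>" "z \<notin> path_image \<gamma>"
  shows "winding_number \<gamma> z = 0 \<longleftrightarrow> z \<notin> inside (path_image \<gamma>)"
proof -
  have "winding_number \<gamma> z = 0" if "z \<notin> inside (path_image \<gamma>)"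
    by (metis that assms ComplI UnE inside_Un_outside simple_path_imp_path winding_number_zero_in_outside)
  then show ?thesis
    using simple_closed_path_norm_winding_number_inside[OF assms(1)] by force
qed

text \<open>The winding numbers of the three cycles about \<open>z\<close> lie in {-1, 0, 1}, so
  they are odd exactly when nonzero, and one of them is the sum of the other two. Hence
  \<open>z\<close> is inside an even number of the cycles.\<close>

lemma theta_inside_parity:
  assumes "theta_arcs a b p q r" and z: "z \<notin> path_image p" "z \<notin> path_image q" "z \<notin> path_image r"
  shows "z \<in> inside (path_image p \<union> path_image q) \<longleftrightarrow>
    (z \<in> inside (path_image p \<union> path_image r) \<longleftrightarrow> z \<notin> inside (path_image q \<union> path_image r))"
proof -
  note t = assms(1)[unfolded theta_arcs_def]
  have sp: "simple_path (p +++ reversepath q)" "simple_path (p +++ reversepath r)" "simple_path (q +++ reversepath r)"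
    using t simple_path_join_reversepath[of _ _ a b] by auto
  have im: "path_image (p +++ reversepath q) = path_image p \<union> path_image q"
       "path_image (p +++ reversepath r) = path_image p \<union> path_image r"
       "path_image (q +++ reversepath r) = path_image q \<union> path_image r"
    using t by (simp_all add: path_image_join)
  let ?w = winding_number
  have w: "?w (p +++ reversepath q) z = ?w p z - ?w q z" "?w (p +++ reversepath r) z = ?w p z - ?w r z"
     "?w (q +++ reversepath r) z = ?w q z - ?w r z"
    using t z by (simp_all add: winding_number_join winding_number_reversepath arc_imp_path)
  have c: "?w (p +++ reversepath q) z \<in> {-1,0,1}" "?w (p +++ reversepath r) z \<in> {-1,0,1}"
     "?w (q +++ reversepath r) z \<in> {-1,0,1}"
    using t z sp im by (simp_all add: simple_closed_path_winding_number_cases del: insert_iff)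
  have e: "?w (p +++ reversepath q) z = 0 \<longleftrightarrow> z \<notin> inside (path_image p \<union> path_image q)"
    "?w (p +++ reversepath r) z = 0 \<longleftrightarrow> z \<notin> inside (path_image p \<union> path_image r)"
    "?w (q +++ reversepath r) z = 0 \<longleftrightarrow> z \<notin> inside (path_image q \<union> path_image r)"
    using t z sp im by (subst winding_number_eq_0_iff_not_inside; simp)+
  have "?w (p +++ reversepath r) z = ?w (p +++ reversepath q) z + ?w (q +++ reversepath r) z"
    unfolding w by simp
  moreover have "x \<noteq> 0 \<longleftrightarrow> (y \<noteq> 0 \<longleftrightarrow> z = 0)"
    if "x \<in> {-1,0,1}" "y \<in> {-1,0,1}" "z \<in> {-1,0,1}" "y = x + z" for x y z :: complex
    using that by auto
  ultimately show ?thesis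
    using c e by blast
qed

section \<open>Nesting of the arcs of a theta curve\<close>

lemma arc_has_inner_point:
  fixes p :: "real \<Rightarrow> complex"
  assumes "arc p"
  obtains y where "y \<in> path_image p" "y \<noteq> pathstart p" "y \<noteq> pathfinish p"
proof
  have "inj_on p {0..1}"
    using assms by (simp add: arc_def)
  then show "p (1/2) \<noteq> pathstart p" "p (1/2) \<noteq> pathfinish p"
    by (auto simp: pathstart_def pathfinish_def inj_on_eq_iff)
  show "p (1/2) \<in> path_image p"
    by (simp add: path_image_def)
qed

lemma theta_Jordan:
  assumes "theta_arcs a b p q r"
  shows "connected (inside (path_image p \<union> path_image q))"
    and "open (inside (path_image p \<union> path_image q))"
    and "open (outside (path_image p \<union> path_image q))"
    and "frontier (inside (path_image p \<union> path_image q)) = path_image p \<union> path_image q"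
proof -
  note t = assms(1)[unfolded theta_arcs_def]
  have sp: "simple_path (p +++ reversepath q)"
    using t simple_path_join_reversepath[of _ _ a b] by auto
  have im: "path_image (p +++ reversepath q) = path_image p \<union> path_image q"
    using t by (simp_all add: path_image_join)
  have loop: "pathfinish (p +++ reversepath q) = pathstart (p +++ reversepath q)"
    using t by simp
  show "connected (inside (path_image p \<union> path_image q))"
    and "open (inside (path_image p \<union> path_image q))"
    and "open (outside (path_image p \<union> path_image q))"
    and "frontier (inside (path_image p \<union> path_image q)) = path_image p \<union> path_image q"
    using Jordan_inside_outside[OF sp loop] unfolding im by simp_all
qed

text \<open>If the arc \<open>r\<close> does not meet the inside of \<open>p \<union> q\<close>, and \<open>p\<close> has a point outside
  of \<open>q \<union> r\<close>, then by parity that point is adjacent to a point lying in both insides.\<close>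
lemma theta_inside_subset:
  assumes t: "theta_arcs a b p q r"
    and pq: "path_image r \<inter> inside (path_image p \<union> path_image q) = {}"
    and y: "y \<in> path_image p" "y \<in> outside (path_image q \<union> path_image r)"
  shows "inside (path_image p \<union> path_image q) \<subseteq> inside (path_image p \<union> path_image r)"
proof -
  let ?I = "\<lambda>p q. inside (path_image p \<union> path_image q)"
  let ?O = "outside (path_image q \<union> path_image r)"
  have t': "theta_arcs a b q r p" "theta_arcs a b p r q"
    using t theta_arcs_rotate theta_arcs_swap by blast+
  have "open ?O"
    using theta_Jordan(3) t' by blast
  moreover have "y \<in> closure (?I p q)"
    using theta_Jordan(4)[OF t] y by (auto simp: frontier_def)
  ultimately have "?O \<inter> ?I p q \<noteq> {}"
    using y(2) by (metis open_Int_closure_eq_empty disjoint_iff)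
  then obtain x where x: "x \<in> ?O" "x \<in> ?I p q"
    by blast
  have "x \<notin> path_image p" "x \<notin> path_image q"
    using x(2) inside_no_overlap[of "path_image p \<union> path_image q"] by blast+
  moreover have "x \<notin> path_image r" "x \<notin> ?I q r"
    using x(1) outside_no_overlap[of "path_image q \<union> path_image r"]
      inside_Int_outside[of "path_image q \<union> path_image r"] by blast+
  ultimately have x': "x \<in> ?I p r"
    using theta_inside_parity[OF t, of x] x by blast
  \<comment> \<open>\<open>?I p q\<close> is connected and meets \<open>?I p r\<close>, so it could
    leave it only across the frontier, formed by the arcs \<open>p\<close> and \<open>r\<close>. But
    \<open>p\<close> bounds \<open>?I p q\<close> and \<open>r\<close> misses it by
    assumption.\<close>
  show ?thesis
  proof (rule ccontr)
    assume "\<not> ?I p q \<subseteq> ?I p r"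
    then have "?I p q \<inter> frontier (?I p r) \<noteq> {}"
      using connected_Int_frontier[OF theta_Jordan(1)[OF t], of "?I p r"] x(2) x' by blast
    then obtain x where "x \<in> ?I p q" "x \<in> path_image p \<union> path_image r"
      unfolding theta_Jordan(4)[OF t'(2)] by blast
    then show False
      using pq inside_no_overlap[of "path_image p \<union> path_image q"] by blast
  qed
qed

text \<open>Otherwise an inner point of \<open>p\<close> is outside the cycle of \<open>q\<close>
  and \<open>r\<close>, and \<open>theta_inside_subset\<close> applies with \<open>q\<close> and
  \<open>r\<close> in either order. The cycles \<open>p\<close>, \<open>q\<close> and
  \<open>p\<close>, \<open>r\<close> then have the same inside, hence the same frontier, which is
  absurd for an inner point of \<open>q\<close>.\<close>

lemma theta_arc_inside_exists:
  assumes t: "theta_arcs a b p q r"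
  shows "path_image r \<inter> inside (path_image p \<union> path_image q) \<noteq> {} \<or>
         path_image q \<inter> inside (path_image p \<union> path_image r) \<noteq> {} \<or>
         path_image p \<inter> inside (path_image q \<union> path_image r) \<noteq> {}"
proof (rule ccontr)
  assume "\<not> ?thesis"
  then have none: "path_image r \<inter> inside (path_image p \<union> path_image q) = {}"
    "path_image q \<inter> inside (path_image p \<union> path_image r) = {}"
    "path_image p \<inter> inside (path_image q \<union> path_image r) = {}" by auto
  have t': "theta_arcs a b p r q"
    using t theta_arcs_rotate theta_arcs_swap by blast
  note t_def = t[unfolded theta_arcs_def]
  obtain y where y: "y \<in> path_image p" "y \<noteq> a" "y \<noteq> b"
    using arc_has_inner_point t_def by metis
  have "y \<notin> path_image q" "y \<notin> path_image r"
    using y t_def by blast+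
  then have out: "y \<in> outside (path_image q \<union> path_image r)"
    using y none(3) inside_Un_outside[of "path_image q \<union> path_image r"] by blast
  have "inside (path_image p \<union> path_image q) = inside (path_image p \<union> path_image r)"
    using theta_inside_subset[OF t none(1) y(1) out]
      theta_inside_subset[OF t' none(2) y(1)] out by (simp add: Un_commute subset_antisym)
  then have "path_image p \<union> path_image q = path_image p \<union> path_image r"
    using theta_Jordan(4)[OF t] theta_Jordan(4)[OF t'] by metis
  moreover obtain x where x: "x \<in> path_image q" "x \<noteq> a" "x \<noteq> b"
    using arc_has_inner_point[of q] t_def by metis
  moreover have "x \<notin> path_image p" "x \<notin> path_image r"
    using t_def x by blast+
  ultimately show False
    by blast
qed

section \<open>Counting enclosed points\<close>

text \<open>An arc entering the inside of the other two cuts that region into the two smaller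
  insides and the open arc itself.\<close>

lemma theta_card_inside:
  assumes t: "theta_arcs a b p q r" and V: "finite V"
    and r: "path_image r \<inter> inside (path_image p \<union> path_image q) \<noteq> {}"
  shows "card (V \<inter> inside (path_image p \<union> path_image q)) =
    card (V \<inter> inside (path_image p \<union> path_image r)) + card (V \<inter> inside (path_image q \<union> path_image r))
      + card (V \<inter> (path_image r - {a, b}))"
proof -
  let ?I = "\<lambda>p q. inside (path_image p \<union> path_image q)"
  note t_def = t[unfolded theta_arcs_def]
  have split: "?I p r \<inter> ?I q r = {}" "?I p r \<union> ?I q r \<union> (path_image r - {a, b}) = ?I p q"
    using split_inside_simple_closed_curve[of p a b q r] t_def r arc_imp_simple_path by metis+
  have "V \<inter> ?I p q = (V \<inter> ?I p r \<union> V \<inter> ?I q r) \<union> V \<inter> (path_image r - {a, b})"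
    using split(2) by blast
  moreover have "(V \<inter> ?I p r \<union> V \<inter> ?I q r) \<inter> (V \<inter> (path_image r - {a, b})) = {}"
    using inside_no_overlap[of "path_image p \<union> path_image r"]
      inside_no_overlap[of "path_image q \<union> path_image r"] by blast
  moreover have "(V \<inter> ?I p r) \<inter> (V \<inter> ?I q r) = {}"
    using split(1) by blast
  ultimately show ?thesis
    using V by (simp add: card_Un_disjoint)
qed

text \<open>\<open>m\<close> carries the common parity of the numbers of inner points of
  \<open>V\<close> on the arcs. Whichever arc is the middle one, the largest count is the sum of the
  other two plus the inner points of that arc, so the total is congruent to
  \<open>m\<close>.\<close>

lemma theta_card_inside_parity:
  assumes t: "theta_arcs a b p q r" and V: "finite V"
    and m: "\<And>s. s \<in> {p, q, r} \<Longrightarrow> even (card (V \<inter> (path_image s - {a, b})) + m)"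
  shows "even (card (V \<inter> inside (path_image p \<union> path_image q)) +
    card (V \<inter> inside (path_image p \<union> path_image r)) + card (V \<inter> inside (path_image q \<union> path_image r)) + m)"
proof -
  have m': "even (card (V \<inter> (path_image p - {a, b})) + m)" "even (card (V \<inter> (path_image q - {a, b})) + m)"
    "even (card (V \<inter> (path_image r - {a, b})) + m)"
    using m by auto
  have t': "theta_arcs a b p r q" "theta_arcs a b q r p"
    using t theta_arcs_rotate theta_arcs_swap by blast+
  consider "path_image r \<inter> inside (path_image p \<union> path_image q) \<noteq> {}"
    | "path_image q \<inter> inside (path_image p \<union> path_image r) \<noteq> {}"
    | "path_image p \<inter> inside (path_image q \<union> path_image r) \<noteq> {}"
    using theta_arc_inside_exists[OF t] by blast
  then show ?thesis
  proof cases
    case 1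
    then show ?thesis
      using theta_card_inside[OF t V] m' by presburger
  next
    case 2
    then show ?thesis
      using theta_card_inside[OF t'(1) V] m' unfolding Un_commute[of "path_image r" "path_image q"]
      by presburger
  next
    case 3
    then show ?thesis
      using theta_card_inside[OF t'(2) V] m'
      unfolding Un_commute[of "path_image q" "path_image p"] Un_commute[of "path_image r" "path_image p"]
      by presburger
  qed
qed

section \<open>Paths in multigraphs\<close>

text \<open>A walk from \<open>u\<close> is the list of its steps, each an edge together with the vertex it leads to;
  thus \<open>verts\<close> below omits the starting vertex.\<close>

fun walk :: "('e \<Rightarrow> 'v set) \<Rightarrow> 'v \<Rightarrow> ('e \<times> 'v) list \<Rightarrow> 'v \<Rightarrow> bool" where
  "walk N u [] v \<longleftrightarrow> u = v"
| "walk N u ((e, w) # p) v \<longleftrightarrow> N e = {u, w} \<and> u \<noteq> w \<and> walk N w p v"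

definition edges :: "('e \<times> 'v) list \<Rightarrow> 'e set" where
  "edges p = fst ` set p"

definition verts :: "('e \<times> 'v) list \<Rightarrow> 'v set" where
  "verts p = snd ` set p"

lemma edges_simps [simp]:
  "edges [] = {}" "edges (x # p) = insert (fst x) (edges p)" "edges (p @ q) = edges p \<union> edges q" "finite (edges p)"
  "edges p = {} \<longleftrightarrow> p = []"
  by (auto simp: edges_def)

lemma verts_simps [simp]:
  "verts [] = {}" "verts (x # p) = insert (snd x) (verts p)" "verts (p @ q) = verts p \<union> verts q" "finite (verts p)"
  by (auto simp: verts_def)

lemma set_map_fst_snd [simp]: "set (map fst p) = edges p" "set (map snd p) = verts p"
    "fst ` set p = edges p" "snd ` set p = verts p"
  by (auto simp: edges_def verts_def)

section \<open>Simple paths\<close>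

definition spath :: "('e \<Rightarrow> 'v set) \<Rightarrow> 'v \<Rightarrow> ('e \<times> 'v) list \<Rightarrow> 'v \<Rightarrow> bool" where
  "spath N u p v \<longleftrightarrow> walk N u p v \<and> distinct (u # map snd p)"

lemma walk_append: "walk N u (p @ q) v \<longleftrightarrow> (\<exists>w. walk N u p w \<and> walk N w q v)"
  by (induction p arbitrary: u) auto

lemma walk_end_in: "walk N u p v \<Longrightarrow> v \<in> insert u (verts p)"
  by (induction p arbitrary: u) auto

lemma walk_functional: "walk N u p v \<Longrightarrow> walk N u p w \<Longrightarrow> v = w"
  by (induction p arbitrary: u) auto

lemma walk_edge_ends:
  assumes "walk N u p v" "e \<in> edges p"
  shows "N e \<subseteq> insert u (verts p)" "card (N e) = 2"
proof -
  have "N e \<subseteq> insert u (verts p) \<and> card (N e) = 2"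
    using assms
  proof (induction p arbitrary: u)
    case (Cons x p)
    obtain f w where x: "x = (f, w)" by fastforce
    show ?case
    proof (cases "e = f")
      case True
      then show ?thesis
        using Cons.prems by (simp add: x)
    next
      case False
      then have "N e \<subseteq> insert w (verts p) \<and> card (N e) = 2"
        using Cons.IH[of w] Cons.prems by (simp add: x)
      then show ?thesis
        by (auto simp: x)
    qed
  qed simp
  then show "N e \<subseteq> insert u (verts p)" "card (N e) = 2"
    by auto
qed

lemma spath_Nil [simp]: "spath N u [] v \<longleftrightarrow> u = v"
  by (simp add: spath_def)

lemma spath_Cons:
  "spath N u ((e, w) # p) v \<longleftrightarrow> N e = {u, w} \<and> u \<noteq> w \<and> u \<notin> verts p \<and> spath N w p v"
  by (auto simp: spath_def)

lemma spath_append: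
  "spath N u (p @ q) v \<longleftrightarrow>
    (\<exists>w. spath N u p w \<and> spath N w q v \<and> insert u (verts p) \<inter> verts q = {})"
proof
  assume *: "spath N u (p @ q) v"
  then obtain w where w: "walk N u p w" "walk N w q v"
    by (auto simp: spath_def walk_append)
  have "insert u (verts p) \<inter> verts q = {}"
    using * by (auto simp: spath_def)
  moreover have "w \<notin> verts q"
    using calculation walk_end_in[OF w(1)] by blast
  ultimately show "\<exists>w. spath N u p w \<and> spath N w q v \<and> insert u (verts p) \<inter> verts q = {}"
    using * w by (auto simp: spath_def)
qed (auto simp: spath_def walk_append)

lemma spath_end_in: "spath N u p v \<Longrightarrow> v \<in> insert u (verts p)"
  using walk_end_in spath_def by metis

lemma spath_start_notin: "spath N u p v \<Longrightarrow> u \<notin> verts p"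
  by (auto simp: spath_def)

lemma spath_loop: "spath N u p u \<Longrightarrow> p = []"
  by (cases p) (auto simp: spath_Cons dest: spath_end_in)

lemma spath_edge_ends:
  assumes "spath N u p v" "e \<in> edges p"
  shows "N e \<subseteq> insert u (verts p)" "card (N e) = 2"
  using assms walk_edge_ends unfolding spath_def by metis+

text \<open>A common edge would have both of its two ends among the shared vertices, of which there
  is at most one.\<close>

lemma spath_edges_disjoint:
  assumes "spath N u p v" "spath N w q x" "insert u (verts p) \<inter> insert w (verts q) \<subseteq> {y}"
  shows "edges p \<inter> edges q = {}"
proof -
  have False if "e \<in> edges p" "e \<in> edges q" for e
  proof -
    have "N e \<subseteq> {y}"
      using spath_edge_ends[OF assms(1) that(1)] spath_edge_ends[OF assms(2) that(2)] assms(3) by blast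
    then have "card (N e) \<le> 1"
      using card_mono[of "{y}" "N e"] by simp
    with spath_edge_ends[OF assms(1) that(1)] show False by simp
  qed
  then show ?thesis by blast
qed

text \<open>A simple path never returns to its start, so no later edge is incident to
  \<open>u\<close>.\<close>

lemma spath_first_edge:
  assumes "spath N u p v" "e \<in> edges p" "u \<in> N e"
  shows "e = fst (hd p)"
proof (cases p)
  case (Cons x p')
  obtain f w where x: "x = (f, w)" by fastforce
  have "e \<notin> edges p'"
    using assms spath_edge_ends(1)[of N w p' v e] by (auto simp: Cons x spath_Cons)
  then show ?thesis
    using assms by (auto simp: Cons x)
qed (use assms in auto)

lemma spath_distinct_edges: "spath N u p v \<Longrightarrow> distinct (map fst p)"
proof (induction p arbitrary: u)
  case (Cons x p)
  obtain f w where x: "x = (f, w)" by fastforce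
  have "f \<notin> edges p"
    using Cons.prems spath_edge_ends(1)[of N w p v f] by (auto simp: x spath_Cons)
  then show ?case
    using Cons by (auto simp: x spath_Cons)
qed simp

lemma spath_card_edges: "spath N u p v \<Longrightarrow> card (edges p) = length p"
  by (metis distinct_card length_map set_map_fst_snd(1) spath_distinct_edges)

lemma spath_card_verts: "spath N u p v \<Longrightarrow> card (verts p) = length p"
  by (metis distinct.simps(2) distinct_card length_map set_map_fst_snd(2) spath_def)

text \<open>Since \<open>verts\<close> omits the start, the vertex sets agree only once both
  starting points are inserted.\<close>

lemma spath_reverse:
  assumes "spath N u p v"
  obtains q where "spath N v q u" "edges q = edges p" "insert v (verts q) = insert u (verts p)"
proof -
  have "\<exists>q. spath N v q u \<and> edges q = edges p \<and> insert v (verts q) = insert u (verts p)"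
    using assms
  proof (induction p arbitrary: u)
    case (Cons x p)
    obtain f w where x: "x = (f, w)" by fastforce
    then obtain q where q: "spath N v q w" "edges q = edges p" "insert v (verts q) = insert w (verts p)"
      using Cons.IH[of w] Cons.prems by (auto simp: spath_Cons)
    have "spath N w [(f, u)] u" "u \<notin> insert v (verts q)"
      using Cons.prems q(3) by (auto simp: x spath_Cons)
    then have "spath N v (q @ [(f, u)]) u"
      using q(1) by (auto simp: spath_append)
    moreover have "insert v (verts (q @ [(f, u)])) = insert u (verts (x # p))"
      using q(3) x by auto
    ultimately show ?case
      using q(2) x by (intro exI[of _ "q @ [(f, u)]"]) auto
  qed (auto intro: exI[of _ "[]"])
  then show ?thesis
    using that by blast
qed

text \<open>The cut is at the first vertex after the start that lies in \<open>S\<close>; the start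
  itself is not tested.\<close>

lemma spath_first_hit:
  assumes "spath N u p v" "verts p \<inter> S \<noteq> {}"
  obtains p1 p2 w where "p = p1 @ p2" "spath N u p1 w" "spath N w p2 v" "p1 \<noteq> []" "verts p1 \<inter> S = {w}"
proof -
  obtain p1 e w p2 where p: "p = p1 @ (e, w) # p2" and w: "w \<in> S" "\<forall>x\<in>set p1. snd x \<notin> S"
    using split_list_first_prop[of p "\<lambda>x. snd x \<in> S"] assms(2) unfolding verts_def by fastforce
  obtain w' where "spath N u (p1 @ [(e, w)]) w'" "spath N w' p2 v"
    using assms(1) spath_append[of N u "p1 @ [(e, w)]" p2 v] p by auto
  moreover from this have "w' = w"
    by (auto simp: spath_append spath_Cons)
  ultimately show ?thesis
    using that[of "p1 @ [(e, w)]" p2 w] p w by (auto simp: verts_def simp del: set_map_fst_snd)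
qed

section \<open>Cycles as pairs of disjoint paths\<close>

text \<open>Such a pair is a cycle through \<open>a\<close> and \<open>b\<close>, split at these
  vertices. Only \<open>b\<close> shows up in the intersection because \<open>verts\<close> omits
  the start. Edge-disjointness excludes taking one single edge as both paths.\<close>

definition disjoint_paths ::
  "('e \<Rightarrow> 'v set) \<Rightarrow> 'v \<Rightarrow> ('e \<times> 'v) list \<Rightarrow> ('e \<times> 'v) list \<Rightarrow> 'v \<Rightarrow> bool" where
  "disjoint_paths N a p q b \<longleftrightarrow> a \<noteq> b \<and> spath N a p b \<and> spath N a q b \<and>
     verts p \<inter> verts q = {b} \<and> edges p \<inter> edges q = {}"

lemma disjoint_paths_sym: "disjoint_paths N a p q b \<Longrightarrow> disjoint_paths N a q p b"
  by (auto simp: disjoint_paths_def)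

text \<open>Removing \<open>e\<close> from the cycle leaves the path that runs from \<open>x\<close>
  back along \<open>p\<close> to \<open>a\<close>, along \<open>q\<close> to \<open>b\<close>, and
  back along \<open>p\<close> to \<open>y\<close>.\<close>

lemma disjoint_paths_open_at_left:
  assumes "disjoint_paths N a p q b" "e \<in> edges p"
  obtains r x y where "spath N x r y" "N e = {x, y}" "edges p \<union> edges q = insert e (edges r)" "e \<notin> edges r"
proof -
  note d = assms(1)[unfolded disjoint_paths_def]
  obtain p1 y p2 where p: "p = p1 @ (e, y) # p2"
    using assms(2) split_list unfolding edges_def by (metis imageE prod.collapse)
  obtain x where x: "spath N a p1 x" "N e = {x, y}" "x \<noteq> y" "spath N y p2 b" "x \<notin> verts p2" "y \<notin> verts p1"
    "a \<noteq> y" "insert a (verts p1) \<inter> verts p2 = {}"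
    using d by (auto simp: p spath_append spath_Cons)
  obtain p1' where p1': "spath N x p1' a" "edges p1' = edges p1" "insert x (verts p1') = insert a (verts p1)"
    using spath_reverse[OF x(1)] by blast
  obtain p2' where p2': "spath N b p2' y" "edges p2' = edges p2" "insert b (verts p2') = insert y (verts p2)"
    using spath_reverse[OF x(4)] by blast
  have b: "b \<notin> verts p2'" "b \<in> insert y (verts p2)" "a \<notin> verts q"
    using spath_start_notin[OF p2'(1)] spath_end_in[OF x(4)] spath_start_notin[of N a q b] d by blast+
  have "verts p \<inter> verts q = {b}"
    using d by blast
  then have dj: "z = b" if "z \<in> verts p1 \<union> insert y (verts p2)" "z \<in> verts q" for z
    using that by (auto simp: p)
  have "b \<notin> insert a (verts p1)"
    using b x by blast
  then have 1: "insert a (verts p1) \<inter> verts q = {}"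
    using dj b by blast
  \<comment> \<open>The reversed \<open>p2'\<close> starts at \<open>b\<close>, so
    \<open>verts p2'\<close> loses the one vertex that \<open>q\<close> shares with
    \<open>p\<close>.\<close>
  have "verts p2' \<subseteq> insert y (verts p2) - {b}"
    using p2'(3) b(1) by blast
  then have 2: "(insert a (verts p1) \<union> verts q) \<inter> verts p2' = {}"
    using dj x by blast
  have "spath N x (p1' @ q) b"
    using p1' d 1 by (auto simp: spath_append)
  moreover have "insert x (verts (p1' @ q)) = insert a (verts p1) \<union> verts q"
    using p1'(3) by auto
  ultimately have "spath N x ((p1' @ q) @ p2') y"
    using p2'(1) 2 spath_append[of N x "p1' @ q" p2' y] by metis
  moreover have "e \<notin> edges p1" "e \<notin> edges p2"
    using d spath_distinct_edges[of N a p b] by (auto simp: p)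
  then have "e \<notin> edges ((p1' @ q) @ p2')"
    using p1'(2) p2'(2) d assms(2) by auto
  moreover have "edges p \<union> edges q = insert e (edges ((p1' @ q) @ p2'))"
    using p1'(2) p2'(2) by (auto simp: p)
  ultimately show ?thesis
    using that x(2) by blast
qed

text \<open>An edge does not fix the order of its ends, so the path may have to be reversed. This
  turns cycles through a new edge into paths between its ends.\<close>

lemma disjoint_paths_open_at:
  assumes "disjoint_paths N a p q b" "e \<in> edges p \<union> edges q" "N e = {u, v}"
  obtains r where "spath N u r v" "edges p \<union> edges q = insert e (edges r)" "e \<notin> edges r"
proof -
  obtain r x y where r: "spath N x r y" "N e = {x, y}" "edges p \<union> edges q = insert e (edges r)" "e \<notin> edges r"
  proof (cases "e \<in> edges p")
    case True
    then show ?thesis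
      using disjoint_paths_open_at_left[OF assms(1)] that by metis
  next
    case False
    then have "e \<in> edges q"
      using assms(2) by blast
    then show ?thesis
      using disjoint_paths_open_at_left[OF disjoint_paths_sym[OF assms(1)]] that by (metis Un_commute)
  qed
  then consider "x = u" "y = v" | "x = v" "y = u"
    using assms(3) by (auto simp: doubleton_eq_iff)
  then show ?thesis
  proof cases
    case 1
    then show ?thesis using r that by blast
  next
    case 2
    with r(1) obtain r' where "spath N u r' v" "edges r' = edges r"
      using spath_reverse by metis
    then show ?thesis using r(3,4) that[of r'] by simp
  qed
qed

section \<open>Signings from theta-additive functions on cycles\<close>

text \<open>This is Zaslavsky's condition: among the three cycles of every theta, one or three have
  even value. Only the parity of \<open>F\<close> matters.\<close>

definition theta_additive :: "('e \<Rightarrow> 'v set) \<Rightarrow> 'e set \<Rightarrow> ('e set \<Rightarrow> nat) \<Rightarrow> bool" where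
  "theta_additive N E F \<longleftrightarrow> (\<forall>a b p q r. edges p \<union> edges q \<union> edges r \<subseteq> E \<longrightarrow>
     disjoint_paths N a p q b \<longrightarrow> disjoint_paths N a p r b \<longrightarrow> disjoint_paths N a q r b \<longrightarrow>
     even (F (edges p \<union> edges q) + F (edges p \<union> edges r) + F (edges q \<union> edges r)))"

text \<open>The labels count modulo 2. Cycles are quantified as pairs of disjoint paths, the form in
  which a theta supplies them.\<close>

definition signing :: "('e \<Rightarrow> 'v set) \<Rightarrow> 'e set \<Rightarrow> ('e set \<Rightarrow> nat) \<Rightarrow> ('e \<Rightarrow> nat) \<Rightarrow> bool" where
  "signing N E F s \<longleftrightarrow> (\<forall>a b p q. edges p \<union> edges q \<subseteq> E \<longrightarrow> disjoint_paths N a p q b \<longrightarrow>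
     even (F (edges p \<union> edges q) + sum s (edges p \<union> edges q)))"

text \<open>Two paths closed up by the same new edge \<open>e\<close> give the same value: the first path is
  rerouted along the first detour of the second one, which changes the closed cycle
  within a theta whose third cycle avoids \<open>e\<close>.\<close>
lemma signing_closing_paths:
  assumes theta: "theta_additive N (insert e E) F" and s: "signing N E F s"
    and e: "e \<notin> E" "N e = {u, v}" "u \<noteq> v"
    and "spath N u (c @ p) v" "spath N u (c @ q) v" "edges (c @ p) \<subseteq> E" "edges (c @ q) \<subseteq> E"
  shows "even (F (insert e (edges (c @ p))) + sum s (edges (c @ p)) +
               (F (insert e (edges (c @ q))) + sum s (edges (c @ q))))"
  using assms(6-9)
\<comment> \<open>\<open>c\<close> is the prefix on which both paths already agree; every round
  lengthens it at the expense of \<open>q\<close>.\<close>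
proof (induction "length q" arbitrary: c p q rule: less_induct)
  case less
  obtain w where p: "spath N u c w" "spath N w p v" "insert u (verts c) \<inter> verts p = {}"
    using less.prems(1) by (auto simp: spath_append)
  obtain w' where "spath N u c w'" and q: "spath N w' q v" "insert u (verts c) \<inter> verts q = {}"
    using less.prems(2) by (auto simp: spath_append)
  moreover have "w' = w"
    using p(1) \<open>spath N u c w'\<close> unfolding spath_def by (metis walk_functional)
  ultimately have q: "spath N w q v" "insert u (verts c) \<inter> verts q = {}"
    by auto
  show ?case
  proof (cases "w = v")
    case True
    then have "p = []" "q = []"
      using spath_loop p(2) q(1) by metis+
    then show ?thesis by simp
  next
    case False
    then have v: "v \<in> verts p" "v \<in> verts q"
      using spath_end_in[OF p(2)] spath_end_in[OF q(1)] by auto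
    then have "p \<noteq> []" "q \<noteq> []" by auto
    show ?thesis
    proof (cases "fst (hd p) = fst (hd q)")
      case True
      obtain f x p' where p': "p = (f, x) # p'"
        using \<open>p \<noteq> []\<close> by (metis list.exhaust surj_pair)
      obtain y q' where q': "q = (f, y) # q'"
        using \<open>q \<noteq> []\<close> True p' by (cases q) auto
      have "x = y"
        using p(2) q(1) by (auto simp: p' q' spath_Cons doubleton_eq_iff)
      then show ?thesis
        using less.hyps[of q' "c @ [(f, x)]" p'] less.prems by (simp add: p' q')
    next
      case first: False
      \<comment> \<open>\<open>q\<close> is followed up to its first vertex \<open>b\<close> on
        \<open>p\<close>, and \<open>p\<close> is cut there too. Then \<open>p1\<close> and
        \<open>q1\<close> join \<open>w\<close> to \<open>b\<close> and meet only at their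
        ends.\<close>
      obtain q1 q2 b where q12: "q = q1 @ q2" "spath N w q1 b" "spath N b q2 v" "q1 \<noteq> []"
        "verts q1 \<inter> verts p = {b}"
        using spath_first_hit[OF q(1), of "verts p"] v by blast
      then obtain p1 p2 b' where p12: "p = p1 @ p2" "spath N w p1 b'" "spath N b' p2 v" "p1 \<noteq> []"
        "verts p1 \<inter> {b} = {b'}"
        using spath_first_hit[OF p(2), of "{b}"] by blast
      then have [simp]: "b' = b" by blast
      have b: "b \<in> verts p1" "b \<in> verts q1" "b \<noteq> w"
        using p12(5) q12(5) spath_start_notin[OF p12(2)] by auto
      have vp: "verts p = verts p1 \<union> verts p2" and vq: "verts q = verts q1 \<union> verts q2"
        using p12(1) q12(1) by auto
      have ep: "edges p = edges p1 \<union> edges p2" and eq: "edges q = edges q1 \<union> edges q2"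
        using p12(1) q12(1) by auto
      have p1p2: "insert w (verts p1) \<inter> verts p2 = {}"
      proof -
        obtain y where "spath N w p1 y" "insert w (verts p1) \<inter> verts p2 = {}"
          using p(2) unfolding p12(1) spath_append by auto
        then show ?thesis by blast
      qed
      have wc: "w \<in> insert u (verts c)"
        using spath_end_in[OF p(1)] by auto
      have dist: "distinct (map fst (c @ p1 @ p2))" "distinct (map fst (c @ q1 @ q2))"
        using spath_distinct_edges less.prems p12(1) q12(1) by metis+
      have ddisj: "edges c \<inter> edges p1 = {}" "edges p1 \<inter> edges p2 = {}" "edges c \<inter> edges p2 = {}"
          "edges c \<inter> edges q1 = {}"
        using dist by auto
      obtain c' where c': "spath N w c' u" "edges c' = edges c" "insert w (verts c') = insert u (verts c)"
        using spath_reverse[OF p(1)] by blast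
      obtain p2' where p2': "spath N v p2' b" "edges p2' = edges p2" "insert v (verts p2') = insert b (verts p2)"
        using spath_reverse p12(3) by (metis \<open>b' = b\<close>)
      \<comment> \<open>The third path of the theta returns from \<open>w\<close> along
        \<open>c\<close> to \<open>u\<close>, crosses \<open>e\<close> to \<open>v\<close> and goes
        back along \<open>p2\<close> to \<open>b\<close>. With \<open>p1\<close> it closes up
        \<open>c @ p\<close>, with \<open>q1\<close> the rerouted path
        \<open>c @ q1 @ p2\<close>.\<close>
      define r where "r = c' @ (e, v) # p2'"
      have er: "edges r = insert e (edges c \<union> edges p2)"
        using c' p2' by (auto simp: r_def)
      have vr: "verts r = verts c' \<union> insert b (verts p2)"
        using p2' by (auto simp: r_def)
      have "spath N u ((e, v) # p2') b"
        using p2' p(3) e vp b by (auto simp: spath_Cons)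
      moreover have "insert w (verts c') \<inter> verts ((e, v) # p2') = {}"
        using p2'(3) c'(3) p(3) vp b by auto
      ultimately have r: "spath N w r b"
        using c'(1) unfolding r_def spath_append by blast
      have "verts p1 \<inter> verts r = {b}"
        using vr b p1p2 c'(3) p(3) vp by blast
      then have d1: "disjoint_paths N w p1 r b"
        using b p12 r ddisj e less.prems(3) ep by (auto simp: disjoint_paths_def er)
      have "verts q1 \<inter> verts r = {b}"
        using vr b q12(5) c'(3) q(2) vp vq by blast
      moreover have "edges q1 \<inter> edges p2 = {}"
        using spath_edges_disjoint[OF q12(2) p12(3), of b] q12(5) wc p(3) vp b by auto
      ultimately have d2: "disjoint_paths N w q1 r b"
        using b q12 r ddisj e less.prems(4) eq by (auto simp: disjoint_paths_def er)
      have "verts p1 \<inter> verts q1 = {b}"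
        using q12(5) vp b by blast
      moreover have "edges p1 \<inter> edges q1 = {}"
      proof -
        \<comment> \<open>A common edge joins \<open>w\<close> to \<open>b\<close>, so it is the
          first edge of both paths; but their first edges differ.\<close>
        have False if "f \<in> edges p1" "f \<in> edges q1" for f
        proof -
          have f: "N f \<subseteq> {w, b}" "card (N f) = 2"
            using spath_edge_ends[OF p12(2) that(1)] spath_edge_ends[OF q12(2) that(2)]
              \<open>verts p1 \<inter> verts q1 = {b}\<close> by blast+
          then have "w \<in> N f"
            by (metis b(3) card_2_iff card_seteq finite.emptyI finite.insertI insertI1 order_refl)
          then have "f = fst (hd p1)" "f = fst (hd q1)"
            using spath_first_edge p12(2) q12(2) that by metis+
          then show False
            using first p12 q12 by simp
        qed
        then show ?thesis by blast
      qed
      ultimately have d3: "disjoint_paths N w p1 q1 b"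
        using b p12 q12 by (auto simp: disjoint_paths_def)
      have cyc: "edges p1 \<union> edges r = insert e (edges (c @ p))"
        "edges q1 \<union> edges r = insert e (edges (c @ q1 @ p2))"
        using er ep by auto
      have E: "edges p1 \<subseteq> E" "edges q1 \<subseteq> E" "edges c \<subseteq> E" "edges p2 \<subseteq> E" "edges q2 \<subseteq> E"
        using less.prems(3,4) ep eq by auto
      have *: "even (F (edges p1 \<union> edges q1) + F (insert e (edges (c @ p)))
          + F (insert e (edges (c @ q1 @ p2))))"
        using theta[unfolded theta_additive_def, rule_format, OF _ d3 d1 d2] E er
        unfolding cyc by auto
      have **: "even (F (edges p1 \<union> edges q1) + sum s (edges p1 \<union> edges q1))"
        using s[unfolded signing_def, rule_format, OF _ d3] E by auto
      have "spath N u (c @ q1) b"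
        using p(1) q12(2) q(2) vq by (auto simp: spath_append)
      moreover have "insert u (verts (c @ q1)) \<inter> verts p2 = {}"
        using p(3) vp q12(5) p1p2 b by auto
      ultimately have "spath N u ((c @ q1) @ p2) v"
        using p12(3) unfolding spath_append[of _ _ "c @ q1"] by auto
      \<comment> \<open>The rerouted path and \<open>c @ q\<close> share the longer prefix
        \<open>c @ q1\<close>, and \<open>q2\<close> is shorter than \<open>q\<close> because
        \<open>q1\<close> is nonempty.\<close>
      then have ***: "even (F (insert e (edges (c @ q1 @ p2))) + sum s (edges (c @ q1 @ p2)) +
               (F (insert e (edges (c @ q))) + sum s (edges (c @ q))))"
        using less.hyps[of q2 "c @ q1" p2] less.prems q12(1,4) E by auto
      have "sum s (edges (c @ p)) = sum s (edges c) + sum s (edges p1) + sum s (edges p2)"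
        using ddisj by (simp add: ep sum.union_disjoint Int_Un_distrib)
      moreover have "sum s (edges (c @ q1 @ p2)) = sum s (edges c) + sum s (edges q1) + sum s (edges p2)"
        using ddisj \<open>edges q1 \<inter> edges p2 = {}\<close> by (simp add: sum.union_disjoint Int_Un_distrib)
      moreover have "sum s (edges p1 \<union> edges q1) = sum s (edges p1) + sum s (edges q1)"
        using \<open>edges p1 \<inter> edges q1 = {}\<close> by (simp add: sum.union_disjoint)
      ultimately show ?thesis
        using * ** *** by presburger
    qed
  qed
qed

text \<open>Edges are added one at a time. A new edge \<open>e\<close> whose ends are joined by a
  path in \<open>E\<close> gets its label from one cycle through \<open>e\<close>, and
  \<open>signing_closing_paths\<close> makes all others agree. If there is no such path, no cycle
  contains \<open>e\<close>.\<close>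

lemma signing_exists:
  assumes "finite E" "theta_additive N E F"
  shows "\<exists>s. signing N E F s"
  using assms
proof (induction E rule: finite_induct)
  case empty
  have "\<not> disjoint_paths N a p q b" if "edges p \<union> edges q \<subseteq> {}" for a b p q
    using that by (auto simp: disjoint_paths_def)
  then show ?case
    unfolding signing_def by blast
next
  case (insert e E)
  have "theta_additive N E F"
    using insert.prems unfolding theta_additive_def by (meson subset_insertI2)
  then obtain s where s: "signing N E F s"
    using insert.IH by blast
  show ?case
  proof (cases "\<exists>u v r. N e = {u, v} \<and> u \<noteq> v \<and> spath N u r v \<and> edges r \<subseteq> E")
    case True
    then obtain u v r where r: "N e = {u, v}" "u \<noteq> v" "spath N u r v" "edges r \<subseteq> E" by blast
    \<comment> \<open>The label of \<open>e\<close> is chosen so that the cycle formed by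
      \<open>e\<close> and \<open>r\<close> satisfies the signing condition.\<close>
    define s' where "s' = s(e := F (insert e (edges r)) + sum s (edges r))"
    have s': "sum s' A = sum s A" if "A \<subseteq> E" for A
      using that insert.hyps(2) by (intro sum.cong) (auto simp: s'_def)
    have "even (F (edges p \<union> edges q) + sum s' (edges p \<union> edges q))"
      if E: "edges p \<union> edges q \<subseteq> insert e E" and d: "disjoint_paths N a p q b" for a b p q
    proof (cases "e \<in> edges p \<union> edges q")
      case True
      then obtain r' where r': "spath N u r' v" "edges p \<union> edges q = insert e (edges r')" "e \<notin> edges r'"
        using disjoint_paths_open_at[OF d _ r(1)] by blast
      have "edges r' \<subseteq> E"
        using E r' by blast
      then have "even (F (insert e (edges r')) + sum s (edges r') + (F (insert e (edges r)) + sum s (edges r)))"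
        using signing_closing_paths[OF insert.prems s insert.hyps(2) r(1,2), of "[]" r' r] r r' by simp
      moreover have "sum s' (insert e (edges r')) = s' e + sum s (edges r')"
        using r'(3) s'[OF \<open>edges r' \<subseteq> E\<close>] by simp
      moreover have "s' e = F (insert e (edges r)) + sum s (edges r)"
        by (simp add: s'_def)
      ultimately show ?thesis
        unfolding r'(2) by presburger
    next
      case False
      then have "edges p \<union> edges q \<subseteq> E"
        using E by blast
      then show ?thesis
        using s[unfolded signing_def, rule_format, OF _ d] s' by simp
    qed
    then show ?thesis
      unfolding signing_def by blast
  next
    case False
    \<comment> \<open>A cycle through \<open>e\<close>, opened at \<open>e\<close>, would be a path
      in \<open>E\<close> between the ends of \<open>e\<close>.\<close>
    have "edges p \<union> edges q \<subseteq> E"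
      if E: "edges p \<union> edges q \<subseteq> insert e E" and d: "disjoint_paths N a p q b" for a b p q
    proof -
      have "e \<notin> edges p \<union> edges q"
      proof
        assume e: "e \<in> edges p \<union> edges q"
        then have "card (N e) = 2"
          using d spath_edge_ends(2) unfolding disjoint_paths_def by (metis Un_iff)
        then obtain u v where uv: "N e = {u, v}" "u \<noteq> v"
          by (auto simp: card_2_iff)
        then obtain r where "spath N u r v" "edges p \<union> edges q = insert e (edges r)" "e \<notin> edges r"
          using disjoint_paths_open_at[OF d e] by blast
        then show False
          using False uv E by blast
      qed
      then show ?thesis
        using E by blast
    qed
    then show ?thesis
      using s unfolding signing_def by blast
  qed
qed

section \<open>Cycles of plane graphs\<close>

lemma spath_Union_ends:
  "spath N u p v \<Longrightarrow> p \<noteq> [] \<Longrightarrow> (\<Union>e\<in>edges p. N e) = insert u (verts p)"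
proof (induction p arbitrary: u)
  case (Cons x p)
  obtain e w where x: "x = (e, w)" by fastforce
  have *: "N e = {u, w}" "spath N w p v"
    using Cons.prems by (auto simp: x spath_Cons)
  show ?case
  proof (cases "p = []")
    case True
    then show ?thesis using * by (auto simp: x)
  next
    case False
    then show ?thesis using Cons.IH[OF *(2)] * by (auto simp: x)
  qed
qed simp

lemma spath_bipartite_parity:
  assumes "\<And>e u w. e \<in> edges p \<Longrightarrow> N e = {u, w} \<Longrightarrow> (u \<in> A) \<noteq> (w \<in> A)" "spath N u p v"
  shows "even (length p) \<longleftrightarrow> (u \<in> A \<longleftrightarrow> v \<in> A)"
  using assms
proof (induction p arbitrary: u)
  case (Cons x p)
  obtain e w where x: "x = (e, w)" by fastforce
  have *: "N e = {u, w}" "spath N w p v"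
    using Cons.prems(2) by (auto simp: x spath_Cons)
  have "even (length p) \<longleftrightarrow> (w \<in> A \<longleftrightarrow> v \<in> A)"
    by (rule Cons.IH[OF _ *(2)]) (rule Cons.prems(1), auto)
  moreover have "(u \<in> A) \<noteq> (w \<in> A)"
    using Cons.prems(1)[of e] * x by simp
  ultimately show ?case
    by auto
qed simp

text \<open>Each step records the vertex it reaches, so the edges are paired with the vertex list
  without its head.\<close>

lemma spath_zip:
  assumes "length vs = Suc (length es)" "distinct vs"
    "\<And>i. i < length es \<Longrightarrow> N (es ! i) = {vs ! i, vs ! Suc i}"
  shows "spath N (hd vs) (zip es (tl vs)) (last vs)"
  using assms
proof (induction es arbitrary: vs)
  case Nil
  then show ?case by (auto simp: length_Suc_conv)
next
  case (Cons e es)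
  then obtain u w vs' where vs: "vs = u # w # vs'"
    by (metis length_Suc_conv)
  have "N (es ! i) = {(w # vs') ! i, (w # vs') ! Suc i}" if "i < length es" for i
    using Cons.prems(3)[of "Suc i"] that by (simp add: vs)
  then have "spath N w (zip es vs') (last vs)"
    using Cons.IH[of "w # vs'"] Cons.prems by (simp add: vs)
  moreover have "verts (zip es vs') \<subseteq> set vs'"
    by (auto simp: verts_def simp del: set_map_fst_snd dest: set_zip_rightD)
  ultimately show ?case
    using Cons.prems Cons.prems(3)[of 0] by (auto simp: vs spath_Cons)
qed

text \<open>The closing edge alone is one path and all other edges form the second, both from the
  first to the last vertex.\<close>

lemma is_cycle_disjoint_paths:
  assumes "is_cycle E g C"
  obtains a b p q where "disjoint_paths (ends g) a p q b" "edges p \<union> edges q = C"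
proof -
  obtain vs es where len: "length es = length vs" "length es \<ge> 2" and dist: "distinct es" "distinct vs"
    and es: "set es = C"
    and e: "\<And>i. i < length es \<Longrightarrow> ends g (es ! i) = {vs ! i, vs ! ((i + 1) mod length es)}"
    using assms unfolding is_cycle_def by blast
  define p where "p = zip (butlast es) (tl vs)"
  have ne: "es \<noteq> []" "vs \<noteq> []"
    using len by auto
  have "ends g (butlast es ! i) = {vs ! i, vs ! Suc i}" if "i < length (butlast es)" for i
    using e[of i] that by (simp add: nth_butlast)
  then have p: "spath (ends g) (hd vs) p (last vs)"
    unfolding p_def using len dist by (intro spath_zip) auto
  have ep: "edges p = set (butlast es)" and vp: "verts p = set (tl vs)"
    using len set_map_fst_snd[of p] unfolding p_def by (metis length_butlast length_tl map_fst_zip map_snd_zip)+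
  have "tl vs \<noteq> []"
    using len by (cases vs) auto
  then have l: "last vs \<in> set (tl vs)"
    by (metis last_in_set last_tl)
  then have hl: "hd vs \<noteq> last vs"
    using dist(2) ne by (metis distinct.simps(2) list.collapse)
  \<comment> \<open>At the last index the successor modulo the length wraps around to
    \<open>hd vs\<close>.\<close>
  have "ends g (last es) = {hd vs, last vs}"
    using e[of "length es - 1"] len ne by (simp add: last_conv_nth hd_conv_nth insert_commute)
  then have q: "spath (ends g) (hd vs) [(last es, last vs)] (last vs)"
    using hl by (simp add: spath_Cons)
  have "es = butlast es @ [last es]"
    using ne by simp
  then have "last es \<notin> set (butlast es)" "set es = insert (last es) (set (butlast es))"
    using dist(1) by (metis distinct_append distinct_singleton disjoint_insert(2) list.set_intros(1) not_distinct_conv_prefix distinct_butlast append_butlast_last_id,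
       metis Un_insert_right list.set(1) list.simps(15) set_append sup_bot_right)
  then show ?thesis
    using that[of "hd vs" p "[(last es, last vs)]" "last vs"] p q ep vp l hl es
    by (auto simp: disjoint_paths_def)
qed

section \<open>Drawings of paths\<close>

lemma plane_multigraphD:
  assumes "plane_multigraph V E g"
  shows "finite V" "finite E"
    and "\<And>e. e \<in> E \<Longrightarrow> arc (g e)"
    and "\<And>e. e \<in> E \<Longrightarrow> path_image (g e) \<inter> V = ends g e"
    and "\<And>e f. e \<in> E \<Longrightarrow> f \<in> E \<Longrightarrow> e \<noteq> f \<Longrightarrow>
      path_image (g e) \<inter> path_image (g f) \<subseteq> ends g e \<inter> ends g f"
proof -
  note G = assms[unfolded plane_multigraph_def]
  show "finite V" "finite E"
    using G[THEN conjunct1] G[THEN conjunct2, THEN conjunct1] .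
  show "arc (g e)" "path_image (g e) \<inter> V = ends g e" if "e \<in> E" for e
    using G[THEN conjunct2, THEN conjunct2, THEN conjunct1, rule_format, OF that] by simp_all
  show "path_image (g e) \<inter> path_image (g f) \<subseteq> ends g e \<inter> ends g f"
    if "e \<in> E" "f \<in> E" "e \<noteq> f" for e f
    using G[THEN conjunct2, THEN conjunct2, THEN conjunct2, THEN conjunct1, rule_format, OF that] .
qed

text \<open>The arcs of the edges are concatenated. Injectivity survives because the first edge
  meets the later ones only at the vertex where they are joined.\<close>

lemma spath_arc:
  assumes G: "plane_multigraph V E g" and "spath (ends g) u p v" "p \<noteq> []" "edges p \<subseteq> E"
  obtains \<gamma> where "arc \<gamma>" "pathstart \<gamma> = u" "pathfinish \<gamma> = v"
    "path_image \<gamma> = (\<Union>e\<in>edges p. path_image (g e))"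
proof -
  have "\<exists>\<gamma>. arc \<gamma> \<and> pathstart \<gamma> = u \<and> pathfinish \<gamma> = v \<and>
      path_image \<gamma> = (\<Union>e\<in>edges p. path_image (g e))"
    using assms(2-)
  proof (induction p arbitrary: u)
    case (Cons x p)
    obtain e w where x: "x = (e, w)" by fastforce
    have *: "ends g e = {u, w}" "u \<noteq> w" "u \<notin> verts p" "spath (ends g) w p v"
      using Cons.prems by (auto simp: x spath_Cons)
    have E: "e \<in> E" "edges p \<subseteq> E"
      using Cons.prems by (auto simp: x)
    \<comment> \<open>\<open>g e\<close> may be parametrised against the direction of
      travel.\<close>
    define h where "h = (if pathstart (g e) = u then g e else reversepath (g e))"
    have h: "arc h" "pathstart h = u" "pathfinish h = w" "path_image h = path_image (g e)"
      using plane_multigraphD(3)[OF G E(1)] *(1,2)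
      by (auto simp: h_def ends_def doubleton_eq_iff arc_reversepath)
    show ?case
    proof (cases "p = []")
      case True
      then show ?thesis
        using h * by (auto simp: x)
    next
      case False
      then obtain \<gamma> where \<gamma>: "arc \<gamma>" "pathstart \<gamma> = w" "pathfinish \<gamma> = v"
        "path_image \<gamma> = (\<Union>e\<in>edges p. path_image (g e))"
        using Cons.IH[OF *(4)] E by blast
      have "path_image (g e) \<inter> path_image (g f) \<subseteq> {w}" if "f \<in> edges p" for f
      proof -
        have "e \<noteq> f"
          using that spath_distinct_edges[OF Cons.prems(1)] by (auto simp: x)
        then have "path_image (g e) \<inter> path_image (g f) \<subseteq> {u, w} \<inter> ends g f"
          using plane_multigraphD(5)[OF G, of e f] E that *(1) by auto
        moreover have "u \<notin> ends g f"
          using spath_edge_ends(1)[OF *(4) that] *(2,3) by blast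
        ultimately show ?thesis by blast
      qed
      then have "path_image h \<inter> path_image \<gamma> \<subseteq> {pathstart \<gamma>}"
        using h(4) \<gamma>(2,4) by blast
      then have "arc (h +++ \<gamma>)"
        using h \<gamma> by (intro arc_join) auto
      then show ?thesis
        using h \<gamma> by (intro exI[of _ "h +++ \<gamma>"]) (auto simp: x path_image_join)
    qed
  qed simp
  then show ?thesis
    using that by blast
qed

lemma spath_vertices:
  assumes "plane_multigraph V E g" "spath (ends g) u p v" "p \<noteq> []" "edges p \<subseteq> E"
  shows "V \<inter> (\<Union>e\<in>edges p. path_image (g e)) = insert u (verts p)"
proof -
  have "V \<inter> (\<Union>e\<in>edges p. path_image (g e)) = (\<Union>e\<in>edges p. path_image (g e) \<inter> V)"
    by blast
  also have "\<dots> = (\<Union>e\<in>edges p. ends g e)"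
    using assms(4) plane_multigraphD(4)[OF assms(1)] by (intro SUP_cong) auto
  finally show ?thesis
    using spath_Union_ends[OF assms(2,3)] by simp
qed

text \<open>Distinct edges meet only in common ends, so a common point of the drawings is a common
  vertex of the paths.\<close>

lemma disjoint_paths_inter:
  assumes G: "plane_multigraph V E g" and d: "disjoint_paths (ends g) a p q b"
    and E: "edges p \<subseteq> E" "edges q \<subseteq> E"
  shows "(\<Union>e\<in>edges p. path_image (g e)) \<inter> (\<Union>e\<in>edges q. path_image (g e)) \<subseteq> {a, b}"
proof
  fix x
  assume "x \<in> (\<Union>e\<in>edges p. path_image (g e)) \<inter> (\<Union>e\<in>edges q. path_image (g e))"
  then obtain e f where *: "x \<in> path_image (g e)" "e \<in> edges p" "x \<in> path_image (g f)" "f \<in> edges q"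
    by blast
  note d' = d[unfolded disjoint_paths_def]
  have "e \<noteq> f"
    using d' * by blast
  then have "x \<in> ends g e \<inter> ends g f"
    using plane_multigraphD(5)[OF G, of e f] * E by blast
  then have "x \<in> insert a (verts p)" "x \<in> insert a (verts q)"
    using spath_edge_ends(1) d' * by (meson IntD1 IntD2 subsetD)+
  then show "x \<in> {a, b}"
    using d' by blast
qed

text \<open>Modulo 2 this is the exponent of the Kasteleyn sign of the cycle: a signing of the edges
  is Kasteleyn iff its product along every cycle is \<open>(-1) ^ cycle_value\<close>.\<close>

definition cycle_value :: "complex set \<Rightarrow> ('e \<Rightarrow> real \<Rightarrow> complex) \<Rightarrow> 'e set \<Rightarrow> nat" where
  "cycle_value V g C = card C div 2 + (chi V g C + 1)"

section \<open>Theta additivity of the Kasteleyn exponent\<close>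

lemma bipartite_paths_parity:
  assumes "bipartite_graph V E g" "spath (ends g) a p b" "spath (ends g) a q b" "edges p \<subseteq> E" "edges q \<subseteq> E"
  shows "even (length p + length q)"
proof -
  obtain A B where AB: "A \<inter> B = {}" "\<And>e. e \<in> E \<Longrightarrow>
      (pathstart (g e) \<in> A \<and> pathfinish (g e) \<in> B) \<or> (pathstart (g e) \<in> B \<and> pathfinish (g e) \<in> A)"
    using assms(1) unfolding bipartite_graph_def by blast
  have "(u \<in> A) \<noteq> (w \<in> A)" if "e \<in> E" "ends g e = {u, w}" for e u w
    using AB(2)[OF that(1)] AB(1) that(2) by (auto simp: ends_def doubleton_eq_iff)
  then have "even (length p) \<longleftrightarrow> (a \<in> A \<longleftrightarrow> b \<in> A)" "even (length q) \<longleftrightarrow> (a \<in> A \<longleftrightarrow> b \<in> A)"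
    using assms(2-) spath_bipartite_parity[of p "ends g" A a b] spath_bipartite_parity[of q "ends g" A a b]
    by (meson subsetD)+
  then show ?thesis by simp
qed

lemma disjoint_paths_card:
  assumes "disjoint_paths N a p q b"
  shows "card (edges p \<union> edges q) = length p + length q"
proof -
  have "card (edges p) = length p" "card (edges q) = length q" "edges p \<inter> edges q = {}"
    using assms unfolding disjoint_paths_def by (metis spath_card_edges)+
  then show ?thesis
    by (simp add: card_Un_disjoint)
qed

text \<open>Modulo 2, the enclosed vertices contribute \<open>length p - 1\<close>, the half-lengths
  \<open>length p\<close>, and the three summands 1 contribute 1, so the total is even.
  Bipartiteness gives the three lengths the same parity.\<close>

lemma theta_additive_cycle_value:
  assumes G: "plane_multigraph V E g" and bip: "bipartite_graph V E g"
  shows "theta_additive (ends g) E (cycle_value V g)"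
  unfolding theta_additive_def
proof (intro allI impI)
  fix a b p q r
  assume E: "edges p \<union> edges q \<union> edges r \<subseteq> E"
    and d: "disjoint_paths (ends g) a p q b" "disjoint_paths (ends g) a p r b" "disjoint_paths (ends g) a q r b"
  let ?U = "\<lambda>p. \<Union>e\<in>edges p. path_image (g e)"
  have sp: "spath (ends g) a p b" "spath (ends g) a q b" "spath (ends g) a r b" "a \<noteq> b"
    using d unfolding disjoint_paths_def by blast+
  then have ne: "p \<noteq> []" "q \<noteq> []" "r \<noteq> []"
    by auto
  have Es: "edges p \<subseteq> E" "edges q \<subseteq> E" "edges r \<subseteq> E"
    using E by auto
  obtain \<gamma>p where p: "arc \<gamma>p" "pathstart \<gamma>p = a" "pathfinish \<gamma>p = b" "path_image \<gamma>p = ?U p"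
    using spath_arc[OF G sp(1) ne(1) Es(1)] by blast
  obtain \<gamma>q where q: "arc \<gamma>q" "pathstart \<gamma>q = a" "pathfinish \<gamma>q = b" "path_image \<gamma>q = ?U q"
    using spath_arc[OF G sp(2) ne(2) Es(2)] by blast
  obtain \<gamma>r where r: "arc \<gamma>r" "pathstart \<gamma>r = a" "pathfinish \<gamma>r = b" "path_image \<gamma>r = ?U r"
    using spath_arc[OF G sp(3) ne(3) Es(3)] by blast
  have ab: "{a, b} \<subseteq> path_image \<gamma>p" "{a, b} \<subseteq> path_image \<gamma>q" "{a, b} \<subseteq> path_image \<gamma>r"
    using p(2,3) q(2,3) r(2,3) pathstart_in_path_image pathfinish_in_path_image
    by (metis empty_subsetI insert_subset)+
  have int: "path_image \<gamma>p \<inter> path_image \<gamma>q \<subseteq> {a, b}" "path_image \<gamma>p \<inter> path_image \<gamma>r \<subseteq> {a, b}"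
    "path_image \<gamma>q \<inter> path_image \<gamma>r \<subseteq> {a, b}"
    unfolding p(4) q(4) r(4) using disjoint_paths_inter[OF G] d Es by metis+
  have t: "theta_arcs a b \<gamma>p \<gamma>q \<gamma>r"
    unfolding theta_arcs_def
    using sp(4) p(1-3) q(1-3) r(1-3) ab int by (simp add: subset_antisym)
  \<comment> \<open>\<open>verts s\<close> has \<open>length s\<close> elements; removing the
    endpoint \<open>b\<close> leaves the inner vertices.\<close>
  have inner: "card (V \<inter> (?U s - {a, b})) = length s - 1"
    if "spath (ends g) a s b" "edges s \<subseteq> E" "s \<noteq> []" for s
  proof -
    have "V \<inter> (?U s - {a, b}) = verts s - {b}"
      using spath_vertices[OF G that(1,3,2)] spath_start_notin[OF that(1)] by blast
    moreover have "b \<in> verts s"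
      using spath_end_in[OF that(1)] sp(4) by simp
    ultimately show ?thesis
      using spath_card_verts[OF that(1)] by simp
  qed
  have par: "even (length p + length q)" "even (length p + length r)" "even (length q + length r)"
    using bipartite_paths_parity[OF bip] sp Es by blast+
  have pos: "length p > 0" "length q > 0" "length r > 0"
    using ne by auto
  \<comment> \<open>\<open>length p - 1\<close> can serve all three arcs because the lengths are
    positive and agree modulo 2.\<close>
  have "even (card (V \<inter> (path_image s - {a, b})) + (length p - 1))" if "s \<in> {\<gamma>p, \<gamma>q, \<gamma>r}" for s
    using that inner[OF sp(1) Es(1) ne(1)] inner[OF sp(2) Es(2) ne(2)] inner[OF sp(3) Es(3) ne(3)]
      p(4) q(4) r(4) par pos by (elim insertE emptyE) (simp; presburger)+
  then have "even (card (V \<inter> inside (?U p \<union> ?U q)) + card (V \<inter> inside (?U p \<union> ?U r)) +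
      card (V \<inter> inside (?U q \<union> ?U r)) + (length p - 1))"
    using theta_card_inside_parity[OF t plane_multigraphD(1)[OF G], of "length p - 1"] p q r by simp
  moreover have chi: "card (V \<inter> inside (?U s \<union> ?U s')) = chi V g (edges s \<union> edges s')" for s s'
    unfolding chi_def by (rule arg_cong[of _ _ card]) auto
  ultimately have chi_even: "even (chi V g (edges p \<union> edges q) + chi V g (edges p \<union> edges r) +
     chi V g (edges q \<union> edges r) + (length p - 1))"
    unfolding chi by blast
  obtain x y z where xyz: "length p + length q = 2 * x" "length p + length r = 2 * y" "length q + length r = 2 * z"
    using par unfolding dvd_def by blast
  then have "x + y + z = length p + 2 * z"
    by linarith
  then have "even (x + y + z + (length p - 1) + 1)"
    using pos by presburger
  then show "even (cycle_value V g (edges p \<union> edges q) + cycle_value V g (edges p \<union> edges r) +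
      cycle_value V g (edges q \<union> edges r))"
    using chi_even unfolding cycle_value_def d[THEN disjoint_paths_card] xyz by simp argo
qed

section \<open>Summation over a decomposition\<close>

text \<open>On each cycle the signing gives the parity of \<open>chi V g C + 1\<close> as that of
  \<open>card C div 2 + sum s C\<close>; these terms add up to a quantity depending on
  \<open>E\<close> alone.\<close>

lemma cycle_decomposition_parity:
  assumes "finite E" "bipartite_graph V E g" "signing (ends g) E (cycle_value V g) s"
    and D: "cycle_decomposition E g D"
  shows "even ((\<Sum>C\<in>D. chi V g C + 1) + (card E div 2 + sum s E))"
proof -
  have cyc: "\<And>C. C \<in> D \<Longrightarrow> is_cycle E g C" and dj: "\<And>C C'. C \<in> D \<Longrightarrow> C' \<in> D \<Longrightarrow> C \<noteq> C' \<Longrightarrow> C \<inter> C' = {}"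
    and UD: "\<Union>D = E"
    using D unfolding cycle_decomposition_def by blast+
  have fin: "\<forall>C\<in>D. finite C"
    using UD assms(1) by (metis Union_upper finite_subset)
  have *: "even (card C) \<and> even (cycle_value V g C + sum s C)" if C: "C \<in> D" for C
  proof -
    obtain a b p q where d: "disjoint_paths (ends g) a p q b" "edges p \<union> edges q = C"
      by (rule is_cycle_disjoint_paths[OF cyc[OF C]])
    have "edges p \<union> edges q \<subseteq> E"
      using d(2) C UD by blast
    then show ?thesis
      using assms(3)[unfolded signing_def, rule_format, OF _ d(1)] disjoint_paths_card[OF d(1)]
        bipartite_paths_parity[OF assms(2), of a p b q] d unfolding disjoint_paths_def by auto
  qed
  have "card E = (\<Sum>C\<in>D. card C)"
    using fin dj unfolding UD[symmetric] by (intro card_Union_disjoint) (auto simp: pairwise_def disjnt_def)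
  \<comment> \<open>Cycles have even length here, so halving loses nothing and commutes with the
    sum.\<close>
  also have "\<dots> = (\<Sum>C\<in>D. 2 * (card C div 2))"
    using * by (intro sum.cong) auto
  finally have "card E div 2 = (\<Sum>C\<in>D. card C div 2)"
    by (simp add: sum_distrib_left[symmetric])
  moreover have "sum s E = (\<Sum>C\<in>D. sum s C)"
    using fin dj unfolding UD[symmetric] by (subst sum.Union_disjoint) auto
  ultimately have "(\<Sum>C\<in>D. chi V g C + 1) + (card E div 2 + sum s E) = (\<Sum>C\<in>D. cycle_value V g C + sum s C)"
    by (simp only: cycle_value_def sum.distrib ac_simps)
  then show ?thesis
    using * by (simp add: dvd_sum)
qed

theorem theorem4p3:
  fixes V :: "complex set" and E :: "'e set" and g :: "'e \<Rightarrow> real \<Rightarrow> complex"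
  assumes "plane_multigraph V E g"
    and "connected_graph V E g"
    and "bipartite_graph V E g"
    and "even_graph V E g"
    and "cycle_decomposition E g D1"
    and "cycle_decomposition E g D2"
  shows "sgn_decomp V g D1 = sgn_decomp V g D2"
proof -
  have fin: "finite E"
    using plane_multigraphD(2)[OF assms(1)] .
  obtain s where s: "signing (ends g) E (cycle_value V g) s"
    using signing_exists[OF fin theta_additive_cycle_value[OF assms(1,3)]] by blast
  \<comment> \<open>Both exponents have the parity of \<open>card E div 2 + sum s E\<close>.\<close>
  have "even (\<Sum>C\<in>D1. chi V g C + 1) \<longleftrightarrow> even (\<Sum>C\<in>D2. chi V g C + 1)"
    using cycle_decomposition_parity[OF fin assms(3) s] assms(5,6) by (meson even_add)
  moreover have "sgn_decomp V g D = (-1) ^ (\<Sum>C\<in>D. chi V g C + 1)" for D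
    unfolding sgn_decomp_def by (simp add: power_sum)
  ultimately show ?thesis
    by (simp add: minus_one_power_iff)
qed

end
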